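(* Let $M = M(S; F(I), G(\Lambda); P)$ be a Rees matrix semigroup (without zero) over a semigroupoid $S$. Suppose the set of non-identity elements of $S$ is weakly right-ideal-generated by a row cross-section of $P$. If $M$ is automatic then $S$ is automatic.
   Context: Semigroupoids. A (directed) graph $X$ has a set $X^0$ of vertices, a set $X^1$ of edges, and source and target maps $\alpha,\omega: X^1\to X^0$. A semigroupoid $S$ is a small graph (vertices are called objects, edges are called arrows) with a partial multiplication on arrows such that $ef$ is defined if and only if $\omega(e)=\alpha(f)$, in which case $\alpha(ef)=\alpha(e)$ and $\omega(ef)=\omega(f)$, and $e(fg)=(ef)g$ whenever $ef$ and $fg$ are defined. (Thus a semigroupoid is a small category without the requirement of identities.) We write $s\in S$ for $s\in S^1$. $S$ is isolation-free if every object is the source or target of some arrow. A semigroup is regarded as a semigroupoid with one object. An identity element of $S$ is an arrow $e$ with $\alpha(e)=\omega(e)$ such that $es=s$ and $te=t$ whenever these products are defined. Paths and regularity. For a graph $X$, $X^+$ is the free semigroupoid on $X$: its objects are $X^0$, its arrows are the non-empty paths $e_1\cdots e_n$ with $\omega(e_i)=\alpha(e_{i+1})$. All graphs over which regularity is considered are finite. A language $L\subseteq X^+$ is regular if it is regular in the usual sense as a set of words over the alphabet $X^1$ (equivalently, it is accepted by a finite automaton labelled by the graph $X$). Let $X^{\$}$ be $X$ with one extra loop $\$_s$ at each vertex $s$. For $(a,b)\in X^+\times X^+$, let $\delta_X(a,b)\in (X^{\$}\times X^{\$})^+$ be the path obtained by padding the shorter of $a,b$ on the right with copies of $\$_t$,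 where $t$ is the target of that shorter path, to the length of the longer one, and reading the two paths as a single path of pairs of edges. A relation $R\subseteq X^+\times X^+$ is synchronously regular if $\delta_X(R)$ is a regular language (over the edges of $X^{\$}\times X^{\$}$). Automaticity. A choice of representatives for a semigroupoid $S$ is a triple $(X,K,\rho)$ where $X$ is a graph with $X^0=S^0$, $\rho:X^+\to S$ is a surjective semigroupoid morphism that is the identity on objects, and $K\subseteq X^+$ satisfies $\rho(K)=S^1$. It is finitely generated if $X$ has finitely many edges. An automatic structure for $S$ is a finitely generated choice of representatives $(X,K,\rho)$ such that the relation $K_a=\{(u,v)\in K\times K : \omega(u)=\alpha(a),\ \rho(ua)=\rho(v)\}$ is synchronously regular for each edge $a\in X^1$, and the relation $K_a=\{(u,v)\in K\times K: \omega(u)=a,\ \rho(u)=\rho(v)\}$ is synchronously regular for each vertex $a\in X^0$ (regarded as an empty path). $S$ is automatic if it admits an automatic structure. Rees matrix semigroups without zero. Let $S$ be a non-empty isolation-free semigroupoid, $I,\Lambda$ index sets, $F:I\to\alpha(S^1)$ and $G:\Lambda\to\omega(S^1)$ surjective functions, and $P$ a $\Lambda\times I$ matrix with entries in $S^1$ (no zero entries) such that $\alpha(P_{\lambda i})=G(\lambda)$ and $\omega(P_{\lambda i})=F(i)$ for all $\lambda\in\Lambda$, $i\in I$. The Rees matrix semigroup (without zero) $M(S;F(I),G(\Lambda);P)$ (the notation $F(I),G(\Lambda)$ is purely symbolic) has elements $\{(i,x,\lambda)\in I\times S\times\Lambda : F(i)=\alpha(x),\ \omega(x)=G(\lambda)\}$,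 with multiplication $(i,x,\lambda)(j,y,\mu)=(i,xP_{\lambda j}y,\mu)$. Right-ideal-generation. A subset $T\subseteq S^1$ is weakly right-ideal-generated by a row cross-section of $P$ if there is a subset $\Lambda'\subseteq\Lambda$ such that $G$ restricts to a bijection $\Lambda'\to\omega(S^1)$ and every arrow in $T$ can be written in the form $P_{\lambda i}s$ or in the form $P_{\lambda i}$ for some $\lambda\in\Lambda'$, $i\in I$ and, where appropriate, $s\in S^1$. *)

theory Defs
  imports Graph_Theory.Arc_Walk
begin

section \<open>Semigroupoids\<close>

text \<open>A semigroupoid is a digraph \<open>S\<close> (objects \<open>verts S\<close>, arrows \<open>arcs S\<close>, source \<open>tail S\<close>,
  target \<open>head S\<close>; not necessarily finite) with a partial multiplication of arrows. The partial
  multiplication is a total function \<open>m\<close> whose values \<open>m e f\<close> matter only when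
  \<open>head S e = tail S f\<close>.\<close>

locale semigroupoid = wf_digraph S for S :: "('v, 'a) pre_digraph" +
  fixes m :: "'a \<Rightarrow> 'a \<Rightarrow> 'a"
  assumes mult_closed:
      "\<lbrakk>e \<in> arcs S; f \<in> arcs S; head S e = tail S f\<rbrakk> \<Longrightarrow> m e f \<in> arcs S"
    and tail_mult:
      "\<lbrakk>e \<in> arcs S; f \<in> arcs S; head S e = tail S f\<rbrakk> \<Longrightarrow> tail S (m e f) = tail S e"
    and head_mult:
      "\<lbrakk>e \<in> arcs S; f \<in> arcs S; head S e = tail S f\<rbrakk> \<Longrightarrow> head S (m e f) = head S f"
    and mult_assoc:
      "\<lbrakk>e \<in> arcs S; f \<in> arcs S; g \<in> arcs S; head S e = tail S f; head S f = tail S g\<rbrakk>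
        \<Longrightarrow> m e (m f g) = m (m e f) g"

definition isolation_free :: "('v, 'a) pre_digraph \<Rightarrow> bool" where
  "isolation_free S \<longleftrightarrow> (\<forall>v \<in> verts S. \<exists>e \<in> arcs S. v = tail S e \<or> v = head S e)"

definition is_identity :: "('v, 'a) pre_digraph \<Rightarrow> ('a \<Rightarrow> 'a \<Rightarrow> 'a) \<Rightarrow> 'a \<Rightarrow> bool" where
  "is_identity S m e \<longleftrightarrow>
     e \<in> arcs S \<and> tail S e = head S e \<and>
     (\<forall>s \<in> arcs S. head S e = tail S s \<longrightarrow> m e s = s) \<and>
     (\<forall>t \<in> arcs S. head S t = tail S e \<longrightarrow> m t e = t)"

definition semigroupoid_hom ::
  "('v, 'a) pre_digraph \<Rightarrow> ('a \<Rightarrow> 'a \<Rightarrow> 'a) \<Rightarrow> ('w, 'b) pre_digraph \<Rightarrow> ('b \<Rightarrow> 'b \<Rightarrow> 'b) \<Rightarrow>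
   ('v \<Rightarrow> 'w) \<Rightarrow> ('a \<Rightarrow> 'b) \<Rightarrow> bool" where
  "semigroupoid_hom S m T n \<phi> \<rho> \<longleftrightarrow>
     \<phi> ` verts S \<subseteq> verts T \<and> \<rho> ` arcs S \<subseteq> arcs T \<and>
     (\<forall>e \<in> arcs S. tail T (\<rho> e) = \<phi> (tail S e) \<and> head T (\<rho> e) = \<phi> (head S e)) \<and>
     (\<forall>e \<in> arcs S. \<forall>f \<in> arcs S. head S e = tail S f \<longrightarrow> \<rho> (m e f) = n (\<rho> e) (\<rho> f))"

text \<open>A semigroup, given by its carrier \<open>A\<close> and its multiplication, is regarded as a semigroupoid
  with one object; this is the underlying graph.\<close>

definition one_object :: "'a set \<Rightarrow> (unit, 'a) pre_digraph" where
  "one_object A = \<lparr>verts = {()}, arcs = A, tail = (\<lambda>_. ()), head = (\<lambda>_. ())\<rparr>"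

section \<open>Paths and regularity\<close>

definition paths :: "('v, 'e) pre_digraph \<Rightarrow> 'e list set" where
  "paths X = {p. p \<noteq> [] \<and> (\<exists>u v. pre_digraph.awalk X u p v)}"

text \<open>The underlying graph of the free semigroupoid on \<open>X\<close>; the multiplication is \<open>(@)\<close>.\<close>

definition free_graph :: "('v, 'e) pre_digraph \<Rightarrow> ('v, 'e list) pre_digraph" where
  "free_graph X = \<lparr>verts = verts X, arcs = paths X,
     tail = (\<lambda>p. tail X (hd p)), head = (\<lambda>p. head X (last p))\<rparr>"

text \<open>A language over the alphabet \<open>A\<close> recognised by a finite deterministic automaton with state
  set \<open>Q\<close>, transition function \<open>d\<close>, initial state \<open>q\<^sub>0\<close> and accepting states \<open>E\<close>. As \<open>Q\<close> is finite,
  it is no restriction to take its elements to be natural numbers.\<close>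

definition regular_language :: "'e set \<Rightarrow> 'e list set \<Rightarrow> bool" where
  "regular_language A L \<longleftrightarrow>
     (\<exists>(Q :: nat set) d q\<^sub>0 E. finite Q \<and> q\<^sub>0 \<in> Q \<and> E \<subseteq> Q \<and>
        (\<forall>q \<in> Q. \<forall>a \<in> A. d q a \<in> Q) \<and>
        L = {w \<in> lists A. foldl d q\<^sub>0 w \<in> E})"

definition regular_over :: "('v, 'e) pre_digraph \<Rightarrow> 'e list set \<Rightarrow> bool" where
  "regular_over X L \<longleftrightarrow> fin_digraph X \<and> L \<subseteq> paths X \<and> regular_language (arcs X) L"

text \<open>\<open>Inl e\<close> is the edge \<open>e\<close> of \<open>X\<close>, and \<open>Inr s\<close> is the extra loop (padding symbol) at the
  vertex \<open>s\<close>.\<close>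

definition pad_graph :: "('v, 'e) pre_digraph \<Rightarrow> ('v, 'e + 'v) pre_digraph" where
  "pad_graph X = \<lparr>verts = verts X, arcs = arcs X <+> verts X,
     tail = case_sum (tail X) id, head = case_sum (head X) id\<rparr>"

definition prod_graph ::
  "('v, 'e) pre_digraph \<Rightarrow> ('w, 'f) pre_digraph \<Rightarrow> ('v \<times> 'w, 'e \<times> 'f) pre_digraph" where
  "prod_graph X Y = \<lparr>verts = verts X \<times> verts Y, arcs = arcs X \<times> arcs Y,
     tail = map_prod (tail X) (tail Y), head = map_prod (head X) (head Y)\<rparr>"

definition pad :: "('v, 'e) pre_digraph \<Rightarrow> nat \<Rightarrow> 'e list \<Rightarrow> ('e + 'v) list" where
  "pad X n p = map Inl p @ replicate (n - length p) (Inr (head X (last p)))"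

definition pad_pair ::
  "('v, 'e) pre_digraph \<Rightarrow> 'e list \<times> 'e list \<Rightarrow> (('e + 'v) \<times> ('e + 'v)) list" where
  "pad_pair X = (\<lambda>(a, b). let n = max (length a) (length b) in zip (pad X n a) (pad X n b))"

definition synchronously_regular ::
  "('v, 'e) pre_digraph \<Rightarrow> ('e list \<times> 'e list) set \<Rightarrow> bool" where
  "synchronously_regular X R \<longleftrightarrow>
     R \<subseteq> paths X \<times> paths X \<and>
     regular_over (prod_graph (pad_graph X) (pad_graph X)) (pad_pair X ` R)"

section \<open>Automatic semigroupoids\<close>

definition choice_of_representatives ::
  "('v, 'a) pre_digraph \<Rightarrow> ('a \<Rightarrow> 'a \<Rightarrow> 'a) \<Rightarrow>
   ('v, 'e) pre_digraph \<Rightarrow> 'e list set \<Rightarrow> ('e list \<Rightarrow> 'a) \<Rightarrow> bool" where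
  "choice_of_representatives S m X K \<rho> \<longleftrightarrow>
     wf_digraph X \<and> verts X = verts S \<and>
     semigroupoid_hom (free_graph X) (@) S m id \<rho> \<and> \<rho> ` paths X = arcs S \<and>
     K \<subseteq> paths X \<and> \<rho> ` K = arcs S"

definition edge_relation ::
  "('v, 'e) pre_digraph \<Rightarrow> 'e list set \<Rightarrow> ('e list \<Rightarrow> 'a) \<Rightarrow> 'e \<Rightarrow> ('e list \<times> 'e list) set" where
  "edge_relation X K \<rho> a =
     {(u, v). u \<in> K \<and> v \<in> K \<and> head X (last u) = tail X a \<and> \<rho> (u @ [a]) = \<rho> v}"

definition vertex_relation ::
  "('v, 'e) pre_digraph \<Rightarrow> 'e list set \<Rightarrow> ('e list \<Rightarrow> 'a) \<Rightarrow> 'v \<Rightarrow> ('e list \<times> 'e list) set" where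
  "vertex_relation X K \<rho> s =
     {(u, v). u \<in> K \<and> v \<in> K \<and> head X (last u) = s \<and> \<rho> u = \<rho> v}"

definition automatic_structure ::
  "('v, 'a) pre_digraph \<Rightarrow> ('a \<Rightarrow> 'a \<Rightarrow> 'a) \<Rightarrow>
   ('v, 'e) pre_digraph \<Rightarrow> 'e list set \<Rightarrow> ('e list \<Rightarrow> 'a) \<Rightarrow> bool" where
  "automatic_structure S m X K \<rho> \<longleftrightarrow>
     choice_of_representatives S m X K \<rho> \<and> finite (arcs X) \<and>
     (\<forall>a \<in> arcs X. synchronously_regular X (edge_relation X K \<rho> a)) \<and>
     (\<forall>s \<in> verts X. synchronously_regular X (vertex_relation X K \<rho> s))"

text \<open>Since \<open>X\<close> has finitely many edges, it is no restriction to name them by natural numbers.\<close>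

definition automatic :: "('v, 'a) pre_digraph \<Rightarrow> ('a \<Rightarrow> 'a \<Rightarrow> 'a) \<Rightarrow> bool" where
  "automatic S m \<longleftrightarrow> (\<exists>(X :: ('v, nat) pre_digraph) K \<rho>. automatic_structure S m X K \<rho>)"

section \<open>Rees matrix semigroups without zero\<close>

locale rees_matrix_data = semigroupoid S m
  for S :: "('v, 'a) pre_digraph" and m :: "'a \<Rightarrow> 'a \<Rightarrow> 'a" +
  fixes I :: "'i set" and \<Lambda> :: "'l set"
    and F :: "'i \<Rightarrow> 'v" and G :: "'l \<Rightarrow> 'v" and P :: "'l \<Rightarrow> 'i \<Rightarrow> 'a"
  assumes nonempty: "verts S \<noteq> {}"
    and isolation_free: "isolation_free S"
    and F_surj: "F ` I = tail S ` arcs S"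
    and G_surj: "G ` \<Lambda> = head S ` arcs S"
    and P_arcs: "\<lbrakk>l \<in> \<Lambda>; i \<in> I\<rbrakk> \<Longrightarrow> P l i \<in> arcs S"
    and P_tail: "\<lbrakk>l \<in> \<Lambda>; i \<in> I\<rbrakk> \<Longrightarrow> tail S (P l i) = G l"
    and P_head: "\<lbrakk>l \<in> \<Lambda>; i \<in> I\<rbrakk> \<Longrightarrow> head S (P l i) = F i"

definition rees_carrier ::
  "('v, 'a) pre_digraph \<Rightarrow> 'i set \<Rightarrow> 'l set \<Rightarrow> ('i \<Rightarrow> 'v) \<Rightarrow> ('l \<Rightarrow> 'v) \<Rightarrow> ('i \<times> 'a \<times> 'l) set" where
  "rees_carrier S I \<Lambda> F G =
     {(i, x, l). i \<in> I \<and> x \<in> arcs S \<and> l \<in> \<Lambda> \<and> F i = tail S x \<and> head S x = G l}"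

definition rees_mult ::
  "('a \<Rightarrow> 'a \<Rightarrow> 'a) \<Rightarrow> ('l \<Rightarrow> 'i \<Rightarrow> 'a) \<Rightarrow> 'i \<times> 'a \<times> 'l \<Rightarrow> 'i \<times> 'a \<times> 'l \<Rightarrow> 'i \<times> 'a \<times> 'l" where
  "rees_mult m P = (\<lambda>(i, x, l) (j, y, k). (i, m (m x (P l j)) y, k))"

definition weakly_right_ideal_generated ::
  "('v, 'a) pre_digraph \<Rightarrow> ('a \<Rightarrow> 'a \<Rightarrow> 'a) \<Rightarrow> 'i set \<Rightarrow> 'l set \<Rightarrow> ('l \<Rightarrow> 'v) \<Rightarrow>
   ('l \<Rightarrow> 'i \<Rightarrow> 'a) \<Rightarrow> 'a set \<Rightarrow> bool" where
  "weakly_right_ideal_generated S m I \<Lambda> G P T \<longleftrightarrow>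
     (\<exists>\<Lambda>' \<subseteq> \<Lambda>. bij_betw G \<Lambda>' (head S ` arcs S) \<and>
        (\<forall>t \<in> T. \<exists>l \<in> \<Lambda>'. \<exists>i \<in> I. t = P l i \<or>
           (\<exists>s \<in> arcs S. head S (P l i) = tail S s \<and> t = m (P l i) s)))"

end

theory Submission
  imports Defs
begin

text \<open>Let \<open>(X, K, \<rho>)\<close> be an automatic structure for \<open>M\<close>, with \<open>\<rho> a = (i\<^sub>a, x\<^sub>a, l\<^sub>a)\<close> for a letter \<open>a\<close>.
  A word \<open>a\<^sub>1 \<dots> a\<^sub>n\<close> is translated, without changing its length, into a path whose first edge stands
  for the arrow \<open>x\<close> of \<open>a\<^sub>1\<close> and whose edge for two consecutive letters \<open>a b\<close> stands for the product of
  the entry of \<open>P\<close> at \<open>l\<^sub>a\<close>, \<open>i\<^sub>b\<close> with \<open>x\<^sub>b\<close>; the value of this path is the middle component of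
  \<open>\<rho> (a\<^sub>1 \<dots> a\<^sub>n)\<close>. The representatives for \<open>S\<close> are the translations of the words
  \<open>u a\<close>, where \<open>u\<close> is empty or in \<open>K\<close>, \<open>a\<close> is a letter, and the row of the first letter lies in a
  cross-section of \<open>F\<close>. The last letter is split off because then multiplying the middle component of
  \<open>\<rho> (u a)\<close> by an arrow \<open>t\<close> amounts to multiplying \<open>\<rho> u\<close> by a fixed element \<open>(i\<^sub>a, x\<^sub>a t, l)\<close> of \<open>M\<close>, and
  right multiplication by a fixed element is a composition of relations \<open>K\<^sub>a\<close>.

  A relation on words is synchronously regular iff it has finitely many quotients by pairs of words,
  where the shorter component must already be exhausted. This description makes closure under
  composition immediate.\<close>

section \<open>Relations with finitely many quotients\<close>

text \<open>Only pairs in this set can be appended to \<open>(p, q)\<close> so that padding commutes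
  with concatenation: a component whose prefix is the shorter one is already being padded and cannot
  resume. Pairs \<open>(p, q)\<close> thus play the part of prefixes read by a synchronous two-tape
  automaton.\<close>

definition aligned :: "'a list \<Rightarrow> 'b list \<Rightarrow> ('a list \<times> 'b list) set" where
  "aligned p q = {(x, y). (length p < length q \<longrightarrow> x = []) \<and> (length q < length p \<longrightarrow> y = [])}"

definition sync_quotient :: "('a list \<times> 'b list) set \<Rightarrow> 'a list \<times> 'b list \<Rightarrow> ('a list \<times> 'b list) set" where
  "sync_quotient R = (\<lambda>(p, q). aligned p q \<inter> {(x, y). (p @ x, q @ y) \<in> R})"

definition recognizable :: "('a list \<times> 'b list) set \<Rightarrow> bool" where
  "recognizable R \<longleftrightarrow> finite (range (sync_quotient R))"

lemma mem_aligned [simp]: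
  "(x, y) \<in> aligned p q \<longleftrightarrow>
     (length p < length q \<longrightarrow> x = []) \<and> (length q < length p \<longrightarrow> y = [])"
  by (simp add: aligned_def)

lemma mem_sync_quotient [simp]:
  "(x, y) \<in> sync_quotient R (p, q) \<longleftrightarrow> (x, y) \<in> aligned p q \<and> (p @ x, q @ y) \<in> R"
  by (simp add: sync_quotient_def)

lemma finite_range_aligned: "finite (range (\<lambda>(p, q). aligned p q))"
proof -
  have "range (\<lambda>(p, q). aligned p q) \<subseteq> {UNIV, {(x, y). x = []}, {(x, y). y = []}}"
    by (auto simp: aligned_def)
  then show ?thesis
    by (rule finite_subset) simp
qed

lemma recognizableI:
  assumes "finite \<Q>" and "\<And>p q. sync_quotient R (p, q) \<in> \<Q>"
  shows "recognizable R"
proof -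
  have "range (sync_quotient R) \<subseteq> \<Q>"
    using assms(2) by auto
  then show ?thesis
    using assms(1) by (simp add: recognizable_def finite_subset)
qed

text \<open>Every quotient consists of pairs of suffixes of members of \<open>R\<close>, and there
  are only finitely many sets of such pairs.\<close>

lemma recognizable_finite:
  assumes "finite R"
  shows "recognizable R"
proof -
  let ?A = "(\<lambda>(p, q). \<Union>n \<in> {..length p}. {drop n p} \<times> {drop k q |k. k \<le> length q}) ` R"
  have "finite (\<Union>?A)"
    using assms by auto
  moreover have "sync_quotient R (p, q) \<in> Pow (\<Union>?A)" for p q
  proof -
    have "(x, y) \<in> \<Union>?A" if "(p @ x, q @ y) \<in> R" for x y
    proof -
      have "(x, y) \<in> (\<Union>n \<in> {..length (p @ x)}.
          {drop n (p @ x)} \<times> {drop k (q @ y) |k. k \<le> length (q @ y)})"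
        by (auto intro!: bexI[of _ "length p"] exI[of _ "length q"])
      then show ?thesis
        using that by blast
    qed
    then show ?thesis
      by auto
  qed
  ultimately show ?thesis
    by (intro recognizableI[of "Pow (\<Union>?A)"]) auto
qed

lemma recognizable_Un:
  assumes "recognizable R" and "recognizable T"
  shows "recognizable (R \<union> T)"
proof (rule recognizableI)
  show "finite ((\<lambda>(A, B). A \<union> B) ` (range (sync_quotient R) \<times> range (sync_quotient T)))"
    using assms by (simp add: recognizable_def)
  show "sync_quotient (R \<union> T) (p, q)
      \<in> (\<lambda>(A, B). A \<union> B) ` (range (sync_quotient R) \<times> range (sync_quotient T))" for p q
  proof
    show "sync_quotient (R \<union> T) (p, q) =
        (\<lambda>(A, B). A \<union> B) (sync_quotient R (p, q), sync_quotient T (p, q))"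
      by (auto simp: sync_quotient_def)
  qed simp
qed

lemma recognizable_UN:
  assumes "finite A" and "\<And>a. a \<in> A \<Longrightarrow> recognizable (R a)"
  shows "recognizable (\<Union>a \<in> A. R a)"
  using assms
  by (induction A rule: finite_induct) (auto intro: recognizable_Un recognizable_finite)

lemma recognizable_converse:
  assumes "recognizable R"
  shows "recognizable (R\<inverse>)"
proof (rule recognizableI)
  show "finite (converse ` range (sync_quotient R))"
    using assms by (simp add: recognizable_def)
  show "sync_quotient (R\<inverse>) (p, q) \<in> converse ` range (sync_quotient R)" for p q
  proof
    show "sync_quotient (R\<inverse>) (p, q) = (sync_quotient R (q, p))\<inverse>"
      by auto
  qed simp
qed

text \<open>The middle word of a pair in a composition is cut at the length of the longer of the two
  prefixes.\<close>

lemma sync_quotient_relcomp: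
  "sync_quotient (R O T) (p, r) = aligned p r \<inter> (\<Union>q. sync_quotient R (p, q) O sync_quotient T (q, r))"
proof (rule equalityI; rule subrelI)
  fix x z
  assume xz: "(x, z) \<in> sync_quotient (R O T) (p, r)"
  then obtain y where y: "(p @ x, y) \<in> R" "(y, r @ z) \<in> T"
    by auto
  define n where "n = max (length p) (length r)"
  \<comment> \<open>If \<open>p\<close> is shorter than \<open>take n y\<close>, it is shorter than
    \<open>r\<close> and \<open>x\<close> is empty because \<open>(x, z)\<close> is aligned; if
    \<open>take n y\<close> is shorter than \<open>p\<close>, then \<open>y\<close> has been used
    up. The same holds for \<open>r\<close> and \<open>z\<close>.\<close>
  have "(x, drop n y) \<in> sync_quotient R (p, take n y)" "(drop n y, z) \<in> sync_quotient T (take n y, r)"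
    using xz y by (auto simp: n_def)
  moreover have "(x, z) \<in> aligned p r"
    using xz by simp
  ultimately show "(x, z) \<in> aligned p r \<inter> (\<Union>q. sync_quotient R (p, q) O sync_quotient T (q, r))"
    by blast
next
  fix x z
  assume "(x, z) \<in> aligned p r \<inter> (\<Union>q. sync_quotient R (p, q) O sync_quotient T (q, r))"
  then show "(x, z) \<in> sync_quotient (R O T) (p, r)"
    by auto
qed

text \<open>By the preceding formula a quotient of the composition depends only on an aligned set
  and on the set of pairs of quotients of \<open>R\<close> and \<open>T\<close> that occur as
  \<open>q\<close> varies. Both range over finite sets.\<close>

lemma recognizable_relcomp:
  assumes "recognizable R" and "recognizable T"
  shows "recognizable (R O T)"
proof (rule recognizableI)
  let ?f = "\<lambda>(A, \<Z>). A \<inter> (\<Union>(B, C) \<in> \<Z>. B O C)"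
  let ?\<Q> = "?f ` (range (\<lambda>(p, q). aligned p q) \<times> Pow (range (sync_quotient R) \<times> range (sync_quotient T)))"
  show "finite ?\<Q>"
    using assms unfolding recognizable_def
    by (intro finite_imageI[of "_ \<times> _"] finite_cartesian_product finite_range_aligned)
      (simp add: finite_cartesian_product)
  show "sync_quotient (R O T) (p, r) \<in> ?\<Q>" for p r
  proof
    show "sync_quotient (R O T) (p, r) =
        ?f (aligned p r, range (\<lambda>q. (sync_quotient R (p, q), sync_quotient T (q, r))))"
      by (simp add: sync_quotient_relcomp)
  qed auto
qed

section \<open>Regular languages and finitely many quotients\<close>

definition left_quotient :: "'e list set \<Rightarrow> 'e list \<Rightarrow> 'e list set" where
  "left_quotient L w = {z. w @ z \<in> L}"

text \<open>This is the Myhill-Nerode theorem: the left quotients serve as the states of an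
  automaton.\<close>

lemma regular_language_iff:
  fixes L :: "'e list set"
  shows "regular_language A L \<longleftrightarrow> L \<subseteq> lists A \<and> finite (range (left_quotient L))"
proof
  assume "regular_language A L"
  then obtain Q :: "nat set" and d q\<^sub>0 E where Q: "finite Q" "q\<^sub>0 \<in> Q" "E \<subseteq> Q"
    "\<forall>q \<in> Q. \<forall>a \<in> A. d q a \<in> Q" and L: "L = {w \<in> lists A. foldl d q\<^sub>0 w \<in> E}"
    unfolding regular_language_def by blast
  have closed: "foldl d q w \<in> Q" if "q \<in> Q" "w \<in> lists A" for q w
    using that(2,1) by (induction w arbitrary: q) (auto simp: Q)
  \<comment> \<open>The extra empty set is the quotient by a word with a letter outside
    \<open>A\<close>, on which the automaton is not controlled.\<close>
  have "left_quotient L w \<in> insert {} ((\<lambda>q. {z \<in> lists A. foldl d q z \<in> E}) ` Q)" for w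
  proof (cases "w \<in> lists A")
    case True
    then have "left_quotient L w = {z \<in> lists A. foldl d (foldl d q\<^sub>0 w) z \<in> E}"
      by (auto simp: left_quotient_def L)
    then show ?thesis
      using closed[OF \<open>q\<^sub>0 \<in> Q\<close> True] by blast
  next
    case False
    then show ?thesis
      by (auto simp: left_quotient_def L)
  qed
  then have "range (left_quotient L) \<subseteq> insert {} ((\<lambda>q. {z \<in> lists A. foldl d q z \<in> E}) ` Q)"
    by blast
  then have "finite (range (left_quotient L))"
    by (rule finite_subset) (simp add: Q(1))
  then show "L \<subseteq> lists A \<and> finite (range (left_quotient L))"
    by (auto simp: L)
next
  assume *: "L \<subseteq> lists A \<and> finite (range (left_quotient L))"
  define \<Q> where "\<Q> = range (left_quotient L)"
  \<comment> \<open>States have to be natural numbers, so the finitely many quotients are numbered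
    by \<open>h\<close>; \<open>d\<close> decodes a number, takes the quotient by one more letter
    and encodes again.\<close>
  obtain h :: "'e list set \<Rightarrow> nat" where h: "inj_on h \<Q>"
    using * finite_imp_inj_to_nat_seg by (metis \<Q>_def)
  define d where "d q a = h (left_quotient (inv_into \<Q> h q) [a])" for q a
  have step: "d (h (left_quotient L w)) a = h (left_quotient L (w @ [a]))" for w a
  proof -
    have "inv_into \<Q> h (h (left_quotient L w)) = left_quotient L w"
      using h by (rule inv_into_f_f) (simp add: \<Q>_def)
    then show ?thesis
      by (simp add: d_def) (simp add: left_quotient_def)
  qed
  have fold: "foldl d (h L) w = h (left_quotient L w)" for w
  proof (induction w rule: rev_induct)
    case Nil
    then show ?case by (simp add: left_quotient_def)
  next
    case (snoc a w)
    then show ?case by (simp add: step)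
  qed
  define E where "E = h ` {q \<in> \<Q>. [] \<in> q}"
  have mem: "h (left_quotient L w) \<in> E \<longleftrightarrow> w \<in> L" for w
  proof -
    have "h (left_quotient L w) \<in> E \<longleftrightarrow> [] \<in> left_quotient L w"
      using h by (auto simp: E_def inj_on_def \<Q>_def)
    then show ?thesis
      by (simp add: left_quotient_def)
  qed
  have "L = left_quotient L []"
    by (simp add: left_quotient_def)
  then have "h L \<in> h ` \<Q>"
    unfolding \<Q>_def by blast
  moreover have "L = {w \<in> lists A. foldl d (h L) w \<in> E}"
    using * by (auto simp add: fold mem)
  moreover have "\<forall>q \<in> h ` \<Q>. \<forall>a \<in> A. d q a \<in> h ` \<Q>"
    by (auto simp: \<Q>_def step)
  moreover have "finite (h ` \<Q>)" "E \<subseteq> h ` \<Q>"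
    using * by (auto simp: E_def \<Q>_def)
  ultimately show "regular_language A L"
    unfolding regular_language_def by blast
qed

section \<open>Synchronous regularity and finitely many quotients\<close>

lemma (in wf_digraph) mem_paths_iff:
  "p \<in> paths G \<longleftrightarrow> p \<noteq> [] \<and> set p \<subseteq> arcs G \<and> successively (\<lambda>e f. head G e = tail G f) p"
proof -
  have cas: "(\<exists>v. cas u p v) \<longleftrightarrow>
      (p \<noteq> [] \<longrightarrow> tail G (hd p) = u) \<and> successively (\<lambda>e f. head G e = tail G f) p" for u
  proof (induction p arbitrary: u)
    case (Cons e p)
    have "(\<exists>v. cas u (e # p) v) \<longleftrightarrow> tail G e = u \<and> (\<exists>v. cas (head G e) p v)"
      by simp
    also have "\<dots> \<longleftrightarrow> (e # p \<noteq> [] \<longrightarrow> tail G (hd (e # p)) = u) \<and>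
        successively (\<lambda>e f. head G e = tail G f) (e # p)"
      by (subst Cons.IH) (auto simp: successively_Cons)
    finally show ?case .
  next
    case Nil
    have "cas u [] u"
      by simp
    then show ?case
      by auto
  qed
  show ?thesis
  proof (cases "p = []")
    case False
    then have "tail G (hd p) \<in> verts G" if "set p \<subseteq> arcs G"
      using that False hd_in_set by (intro tail_in_verts) blast
    then show ?thesis
      using False cas unfolding paths_def awalk_def by blast
  qed (simp add: paths_def)
qed

section \<open>Padding of a pair of paths from a given prefix onwards\<close>

definition end_vertex :: "('v, 'e) pre_digraph \<Rightarrow> 'v \<Rightarrow> 'e list \<Rightarrow> 'v" where
  "end_vertex X s x = (if x = [] then s else head X (last x))"

text \<open>The vertex \<open>s\<close> is the end of the prefix already read. It supplies the
  padding symbol when the remainder \<open>x\<close> is empty and has no last edge of its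
  own.\<close>

definition pad_from :: "('v, 'e) pre_digraph \<Rightarrow> 'v \<Rightarrow> nat \<Rightarrow> 'e list \<Rightarrow> ('e + 'v) list" where
  "pad_from X s n x = map Inl x @ replicate (n - length x) (Inr (end_vertex X s x))"

definition pad_pair_from ::
  "('v, 'e) pre_digraph \<Rightarrow> 'v \<Rightarrow> 'v \<Rightarrow> 'e list \<times> 'e list \<Rightarrow> (('e + 'v) \<times> ('e + 'v)) list" where
  "pad_pair_from X s t = (\<lambda>(x, y). let n = max (length x) (length y) in
     zip (pad_from X s n x) (pad_from X t n y))"

lemma pad_pair_eq_pad_pair_from:
  "x \<noteq> [] \<Longrightarrow> y \<noteq> [] \<Longrightarrow> pad_pair X (x, y) = pad_pair_from X s t (x, y)"
  by (simp add: pad_pair_def pad_pair_from_def pad_def pad_from_def end_vertex_def)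

lemma length_pad_from [simp]: "length (pad_from X s n x) = max n (length x)"
  by (simp add: pad_from_def)

lemma length_pad_pair_from: "length (pad_pair_from X s t (x, y)) = max (length x) (length y)"
  by (simp add: pad_pair_from_def Let_def)

text \<open>If \<open>p\<close> needs padding, alignment makes \<open>x\<close> empty, so the
  padding of \<open>p\<close> is simply prolonged at the same vertex; otherwise no padding separates
  \<open>p\<close> from \<open>x\<close>.\<close>

lemma pad_from_append:
  assumes "(x, y) \<in> aligned p q"
  shows "pad_from X s (max (length (p @ x)) (length (q @ y))) (p @ x) =
    pad_from X s (max (length p) (length q)) p @
    pad_from X (end_vertex X s p) (max (length x) (length y)) x"
  using assms
  by (cases "length p" "length q" rule: linorder_cases)
    (auto simp: pad_from_def end_vertex_def max_def replicate_add[symmetric])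

lemma pad_pair_from_append:
  assumes "(x, y) \<in> aligned p q"
  shows "pad_pair_from X s t (p @ x, q @ y) =
    pad_pair_from X s t (p, q) @ pad_pair_from X (end_vertex X s p) (end_vertex X t q) (x, y)"
proof -
  have "(y, x) \<in> aligned q p"
    using assms by auto
  note this[THEN pad_from_append, of X t]
  then show ?thesis
    using pad_from_append[OF assms, of X s]
    by (simp add: pad_pair_from_def Let_def max.commute del: length_append)
qed

text \<open>Deleting the padding symbols from each track recovers both words.\<close>

lemma inj_pad_pair_from: "inj (pad_pair_from X s t)"
proof (rule inj_on_inverseI, clarify)
  let ?lefts = "\<lambda>w. concat (map (case_sum (\<lambda>e. [e]) (\<lambda>_. [])) w)"
  have pad: "?lefts (pad_from X s n x) = x" for s n x
    by (simp add: pad_from_def comp_def)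
  show "(\<lambda>w. (?lefts (map fst w), ?lefts (map snd w))) (pad_pair_from X s t (x, y)) = (x, y)" for x y
    by (simp add: pad_pair_from_def Let_def pad)
qed

lemma fin_digraph_prod_pad_graph:
  assumes "fin_digraph X"
  shows "fin_digraph (prod_graph (pad_graph X) (pad_graph X))"
proof -
  interpret fin_digraph X by fact
  show ?thesis
    by unfold_locales (auto simp: prod_graph_def pad_graph_def)
qed

lemma pad_pair_in_paths:
  assumes X: "fin_digraph X" and "a \<in> paths X" and "b \<in> paths X"
  shows "pad_pair X (a, b) \<in> paths (prod_graph (pad_graph X) (pad_graph X))" (is "_ \<in> paths ?Y")
proof -
  interpret fin_digraph X by (fact X)
  interpret Y: fin_digraph ?Y
    using X by (rule fin_digraph_prod_pad_graph)
  have pad: "pad X n p \<noteq> [] \<and> set (pad X n p) \<subseteq> arcs (pad_graph X) \<and>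
      successively (\<lambda>e f. head (pad_graph X) e = tail (pad_graph X) f) (pad X n p)"
    if p: "p \<in> paths X" for n p
  proof -
    have "head X (last p) \<in> verts X"
      using p by (auto simp: mem_paths_iff intro!: head_in_verts)
    moreover have "successively (\<lambda>e f. head (pad_graph X) e = tail (pad_graph X) f) (replicate k (Inr s))" for k s
      by (simp add: successively_conv_nth pad_graph_def)
    moreover have "hd (replicate k z) = z" if "0 < k" for k and z :: "'b + 'a"
      using that by (cases k) simp_all
    ultimately show ?thesis
      using p
      by (cases "n \<le> length p") (auto simp: pad_def mem_paths_iff successively_append_iff successively_map pad_graph_def
          last_map)
  qed
  define n where "n = max (length a) (length b)"
  have n: "length (pad X n a) = n" "length (pad X n b) = n" "n \<noteq> 0"
    using pad assms by (auto simp: n_def pad_def mem_paths_iff)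
  have "zip (pad X n a) (pad X n b) \<in> paths ?Y"
    unfolding Y.mem_paths_iff
  proof (intro conjI)
    show "zip (pad X n a) (pad X n b) \<noteq> []"
      using n by (metis length_0_conv length_zip min.idem)
    show "set (zip (pad X n a) (pad X n b)) \<subseteq> arcs ?Y"
    proof (rule subsetI, clarify)
      fix c d
      assume "(c, d) \<in> set (zip (pad X n a) (pad X n b))"
      then have "c \<in> set (pad X n a)" "d \<in> set (pad X n b)"
        by (rule set_zip_leftD, rule set_zip_rightD)
      then have "c \<in> arcs (pad_graph X)" "d \<in> arcs (pad_graph X)"
        using pad[OF assms(2), of n] pad[OF assms(3), of n] by blast+
      then show "(c, d) \<in> arcs ?Y"
        by (simp add: prod_graph_def)
    qed
    show "successively (\<lambda>e f. head ?Y e = tail ?Y f) (zip (pad X n a) (pad X n b))"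
      using pad[OF assms(2)] pad[OF assms(3)]
      by (auto simp: successively_conv_nth n prod_graph_def)
  qed
  then show ?thesis
    by (simp add: pad_pair_def Let_def n_def)
qed

text \<open>Quotients of the padded language and quotients of \<open>R\<close> determine each other
  once the end vertices of the two prefixes are known, and these lie in a finite set. So one family
  is finite iff the other is.\<close>

lemma synchronously_regular_iff:
  assumes X: "fin_digraph X"
  shows "synchronously_regular X R \<longleftrightarrow> R \<subseteq> paths X \<times> paths X \<and> recognizable R"
proof (cases "R \<subseteq> paths X \<times> paths X")
  case R: True
  interpret fin_digraph X by (fact X)
  let ?Y = "prod_graph (pad_graph X) (pad_graph X)"
  let ?L = "pad_pair X ` R"
  interpret Y: fin_digraph ?Y
    using X by (rule fin_digraph_prod_pad_graph)
  \<comment> \<open>An arbitrary end vertex for the empty prefix; it is added to \<open>V\<close>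
    because it may lie outside the graph.\<close>
  define s\<^sub>0 :: 'a where "s\<^sub>0 = undefined"
  define V where "V = insert s\<^sub>0 (verts X)"
  have [simp]: "finite V"
    by (simp add: V_def)
  have "a \<noteq> []" "b \<noteq> []" "set a \<subseteq> arcs X" "set b \<subseteq> arcs X" if "(a, b) \<in> R" for a b
  proof -
    have "a \<in> paths X" "b \<in> paths X"
      using R that by auto
    then show "a \<noteq> []" "b \<noteq> []" "set a \<subseteq> arcs X" "set b \<subseteq> arcs X"
      by (simp_all add: mem_paths_iff)
  qed
  note R_paths = this
  have L: "?L = pad_pair_from X s\<^sub>0 s\<^sub>0 ` R"
    by (rule image_cong) (auto intro!: pad_pair_eq_pad_pair_from dest: R_paths)
  have V: "end_vertex X s\<^sub>0 p \<in> V" if "set p \<subseteq> arcs X" for p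
    using that by (auto simp: end_vertex_def V_def intro!: head_in_verts)
  have L_paths: "?L \<subseteq> paths ?Y"
    using R X by (auto intro: pad_pair_in_paths)
  then have "?L \<subseteq> lists (arcs ?Y)"
    using Y.mem_paths_iff by auto
  then have "synchronously_regular X R \<longleftrightarrow> finite (range (left_quotient ?L))"
    using R L_paths Y.fin_digraph_axioms
    by (simp add: synchronously_regular_def regular_over_def regular_language_iff)
  also have "\<dots> \<longleftrightarrow> recognizable R"
  proof
    assume fin: "finite (range (left_quotient ?L))"
    let ?f = "\<lambda>(A, s, t, W). A \<inter> pad_pair_from X s t -` W"
    show "recognizable R"
    proof (rule recognizableI)
      let ?\<Q> = "?f ` (range (\<lambda>(p, q). aligned p q) \<times> V \<times> V \<times> range (left_quotient ?L))"
      show "finite (insert {} ?\<Q>)"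
        using fin by (intro finite.insertI finite_imageI[of "_ \<times> _"] finite_cartesian_product
            finite_range_aligned) simp_all
      show "sync_quotient R (p, q) \<in> insert {} ?\<Q>" for p q
      proof (cases "set p \<subseteq> arcs X \<and> set q \<subseteq> arcs X")
        case True
        have "sync_quotient R (p, q) = ?f (aligned p q, end_vertex X s\<^sub>0 p, end_vertex X s\<^sub>0 q,
            left_quotient ?L (pad_pair_from X s\<^sub>0 s\<^sub>0 (p, q)))"
          unfolding L left_quotient_def sync_quotient_def
          by (auto simp: pad_pair_from_append[symmetric] simp del: mem_aligned
              dest: injD[OF inj_pad_pair_from])
        moreover have "(aligned p q, end_vertex X s\<^sub>0 p, end_vertex X s\<^sub>0 q,
            left_quotient ?L (pad_pair_from X s\<^sub>0 s\<^sub>0 (p, q))) \<in>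
            range (\<lambda>(p, q). aligned p q) \<times> V \<times> V \<times> range (left_quotient ?L)"
          using True V by auto
        ultimately show ?thesis
          by (intro insertI2) (rule image_eqI)
      next
        case False
        then have "(p @ x, q @ y) \<notin> R" for x y
          using R_paths(3,4)[of "p @ x" "q @ y"] by auto
        then have "sync_quotient R (p, q) = {}"
          by auto
        then show ?thesis
          by simp
      qed
    qed
  next
    assume fin: "recognizable R"
    let ?f = "\<lambda>(Q, s, t). pad_pair_from X s t ` Q"
    let ?\<W> = "?f ` (range (sync_quotient R) \<times> V \<times> V)"
    have "left_quotient ?L w \<in> insert {} ?\<W>" for w
    proof (cases "left_quotient ?L w = {}")
      case False
      \<comment> \<open>Every member of the padded language that extends \<open>w\<close> is cut
        after \<open>k\<close> letters: the left part is the padded pair of the two initial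
        segments, the right part is the padded rest.\<close>
      define k where "k = length w"
      have cut: "(drop k a, drop k b) \<in> aligned (take k a) (take k b)"
        "pad_pair_from X s\<^sub>0 s\<^sub>0 (take k a, take k b) = w"
        "z = pad_pair_from X (end_vertex X s\<^sub>0 (take k a)) (end_vertex X s\<^sub>0 (take k b)) (drop k a, drop k b)"
        if ab: "pad_pair_from X s\<^sub>0 s\<^sub>0 (a, b) = w @ z" for a b z
      proof -
        show al: "(drop k a, drop k b) \<in> aligned (take k a) (take k b)"
          by auto
        have "k \<le> max (length a) (length b)"
          using arg_cong[OF ab, of length] by (simp add: length_pad_pair_from k_def)
        then have "length (pad_pair_from X s\<^sub>0 s\<^sub>0 (take k a, take k b)) = length w"
          by (auto simp add: length_pad_pair_from k_def)
        moreover have "pad_pair_from X s\<^sub>0 s\<^sub>0 (take k a, take k b) @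
          pad_pair_from X (end_vertex X s\<^sub>0 (take k a)) (end_vertex X s\<^sub>0 (take k b)) (drop k a, drop k b)
          = w @ z"
          unfolding pad_pair_from_append[OF al, symmetric] using ab by simp
        ultimately show
          "pad_pair_from X s\<^sub>0 s\<^sub>0 (take k a, take k b) = w"
          "z = pad_pair_from X (end_vertex X s\<^sub>0 (take k a)) (end_vertex X s\<^sub>0 (take k b)) (drop k a, drop k b)"
          by simp_all
      qed
      obtain z where "w @ z \<in> pad_pair_from X s\<^sub>0 s\<^sub>0 ` R"
        using False unfolding left_quotient_def L by blast
      then obtain a b where ab: "(a, b) \<in> R" "pad_pair_from X s\<^sub>0 s\<^sub>0 (a, b) = w @ z"
        by (metis imageE surj_pair)
      define p q where "p = take k a" and "q = take k b"
      have w: "pad_pair_from X s\<^sub>0 s\<^sub>0 (p, q) = w"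
        using cut(2)[OF ab(2)] by (simp add: p_def q_def)
      have "left_quotient ?L w = ?f (sync_quotient R (p, q), end_vertex X s\<^sub>0 p, end_vertex X s\<^sub>0 q)"
      proof (intro set_eqI iffI)
        fix z
        assume "z \<in> left_quotient ?L w"
        then obtain a b where ab: "(a, b) \<in> R" "pad_pair_from X s\<^sub>0 s\<^sub>0 (a, b) = w @ z"
          unfolding left_quotient_def L by (metis imageE mem_Collect_eq surj_pair)
        \<comment> \<open>Padding is injective, so all pairs whose padded word begins with
          \<open>w\<close> have the same initial segments.\<close>
        have "take k a = p \<and> take k b = q"
          using cut(2)[OF ab(2)] w injD[OF inj_pad_pair_from] by (metis prod.inject)
        then have "(drop k a, drop k b) \<in> sync_quotient R (p, q)"
          "z = pad_pair_from X (end_vertex X s\<^sub>0 p) (end_vertex X s\<^sub>0 q) (drop k a, drop k b)"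
          using ab(1) cut(1,3)[OF ab(2)] by auto
        then show "z \<in> ?f (sync_quotient R (p, q), end_vertex X s\<^sub>0 p, end_vertex X s\<^sub>0 q)"
          by blast
      next
        fix z
        assume "z \<in> ?f (sync_quotient R (p, q), end_vertex X s\<^sub>0 p, end_vertex X s\<^sub>0 q)"
        then obtain x y where "(x, y) \<in> aligned p q" "(p @ x, q @ y) \<in> R"
          "z = pad_pair_from X (end_vertex X s\<^sub>0 p) (end_vertex X s\<^sub>0 q) (x, y)"
          unfolding sync_quotient_def by (auto simp del: mem_aligned)
        then show "z \<in> left_quotient ?L w"
          unfolding left_quotient_def L w[symmetric]
          using pad_pair_from_append by (metis (mono_tags, lifting) imageI mem_Collect_eq)
      qed
      moreover have "end_vertex X s\<^sub>0 p \<in> V" "end_vertex X s\<^sub>0 q \<in> V"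
        using R_paths[OF ab(1)] by (auto simp: p_def q_def intro!: V dest: in_set_takeD)
      ultimately show ?thesis
        by blast
    qed simp
    then have "range (left_quotient ?L) \<subseteq> insert {} ?\<W>"
      by blast
    moreover have "finite ?\<W>"
      using fin by (simp add: recognizable_def)
    ultimately show "finite (range (left_quotient ?L))"
      by (simp add: finite_subset)
  qed
  finally show ?thesis
    using R by simp
next
  case False
  then show ?thesis
    by (simp add: synchronously_regular_def)
qed

section \<open>Three recognizable relations\<close>

text \<open>Each letter is recorded together with its predecessor; the state \<open>0\<close> stands for the beginning
  of the word and \<open>Suc a\<close> for the predecessor \<open>a\<close>.\<close>

fun pair_code_from :: "nat \<Rightarrow> nat list \<Rightarrow> nat list" where
  "pair_code_from c [] = []"
| "pair_code_from c (a # w) = prod_encode (c, a) # pair_code_from (Suc a) w"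

abbreviation pair_code :: "nat list \<Rightarrow> nat list" where
  "pair_code \<equiv> pair_code_from 0"

definition code_state :: "nat \<Rightarrow> nat list \<Rightarrow> nat" where
  "code_state c p = (if p = [] then c else Suc (last p))"

lemma length_pair_code_from [simp]: "length (pair_code_from c w) = length w"
  by (induction w arbitrary: c) auto

lemma pair_code_from_append:
  "pair_code_from c (p @ x) = pair_code_from c p @ pair_code_from (code_state c p) x"
  by (induction p arbitrary: c) (auto simp: code_state_def)

text \<open>The coding is a letter-to-letter transduction, so a non-empty quotient is the same
  coding started in the state reached after \<open>p\<close>, and the states are \<open>0\<close>
  and \<open>Suc a\<close> for letters \<open>a\<close>.\<close>

lemma recognizable_pair_code:
  assumes "finite A"
  shows "recognizable {(w, pair_code w) |w. w \<in> lists A}"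
proof (rule recognizableI)
  let ?R = "\<lambda>c. {(w, pair_code_from c w) |w. w \<in> lists A}"
  let ?\<Q> = "insert {} (?R ` insert 0 (Suc ` A))"
  show "finite ?\<Q>"
    using assms by simp
  show "sync_quotient (?R 0) (p, q) \<in> ?\<Q>" for p q
  proof (cases "p \<in> lists A \<and> q = pair_code p")
    case True
    then have "sync_quotient (?R 0) (p, q) = ?R (code_state 0 p)"
      by (auto simp: pair_code_from_append)
    moreover have "code_state 0 p \<in> insert 0 (Suc ` A)"
      using True by (auto simp: code_state_def)
    ultimately show ?thesis
      by blast
  next
    case False
    have "sync_quotient (?R 0) (p, q) \<subseteq> {}"
    proof (rule subrelI)
      fix x y
      assume xy: "(x, y) \<in> sync_quotient (?R 0) (p, q)"
      then have eq: "q @ y = pair_code p @ pair_code_from (code_state 0 p) x" and "p \<in> lists A"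
        by (auto simp: pair_code_from_append)
      \<comment> \<open>The words of a related pair have equal length, while alignment gives the
        component with the shorter prefix an empty remainder.\<close>
      moreover have "length q = length p"
        using arg_cong[OF eq, of length] xy
        by (cases "length p" "length q" rule: linorder_cases) auto
      ultimately show "(x, y) \<in> {}"
        using False by simp
    qed
    then show ?thesis
      by (simp only: subset_empty insertI1)
  qed
qed

text \<open>The second word is ahead by at most one letter: either the prefixes agree and nothing
  has been decided, or only the final \<open>a\<close> was added and both words have ended.\<close>

lemma recognizable_snoc: "recognizable (range (\<lambda>u. (u, u @ [a])))"
proof (rule recognizableI)
  let ?R = "range (\<lambda>u. (u, u @ [a]))"
  show "finite {{}, ?R, {([], [])}}"
    by simp
  show "sync_quotient ?R (p, q) \<in> {{}, ?R, {([], [])}}" for p q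
  proof (cases "length p" "length q" rule: linorder_cases)
    case less
    have "sync_quotient ?R (p, q) \<subseteq> {([], [])}"
    proof (rule subrelI)
      fix x y
      assume "(x, y) \<in> sync_quotient ?R (p, q)"
      then have "x = []" and eq: "q @ y = p @ [a]"
        using less by auto
      moreover have "length q + length y = Suc (length p)"
        using arg_cong[OF eq, of length] by simp
      then have "length y = 0"
        using less by linarith
      ultimately show "(x, y) \<in> {([], [])}"
        by simp
    qed
    then show ?thesis
      unfolding subset_singleton_iff by (elim disjE) simp_all
  next
    case equal
    then have "sync_quotient ?R (p, q) = (if p = q then ?R else {})"
      by auto
    then show ?thesis
      by simp
  next
    case greater
    then have "sync_quotient ?R (p, q) = {}"
      by (auto dest: arg_cong[of _ _ length])
    then show ?thesis
      by simp
  qed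
qed

text \<open>A partial identity that filters words in a composition. The first letter settles the
  test, after which either \<open>Id\<close> or the empty relation is left.\<close>

lemma recognizable_hd: "recognizable {(w, w) |w. w \<noteq> [] \<and> hd w \<in> H}"
proof (rule recognizableI)
  let ?R = "{(w, w) |w. w \<noteq> [] \<and> hd w \<in> H}"
  show "finite {{}, ?R, Id}"
    by simp
  show "sync_quotient ?R (p, q) \<in> {{}, ?R, Id}" for p q
  proof -
    have "sync_quotient ?R (p, q) = (if p \<noteq> q \<or> p \<noteq> [] \<and> hd p \<notin> H then {} else if p = [] then ?R else Id)"
      by (cases "length p" "length q" rule: linorder_cases)
        (auto simp: append_eq_append_conv dest: arg_cong[of _ _ length])
    then show ?thesis
      by simp
  qed
qed

section \<open>The automatic structure\<close>

text \<open>A semigroupoid need not have identities to start a product with, so the fold starts from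
  the value of the first edge.\<close>

abbreviation path_value :: "('a \<Rightarrow> 'a \<Rightarrow> 'a) \<Rightarrow> ('e \<Rightarrow> 'a) \<Rightarrow> 'e list \<Rightarrow> 'a" where
  "path_value m val p \<equiv> foldl m (val (hd p)) (map val (tl p))"

text \<open>The universal property of the free semigroupoid: a graph map that fixes objects extends
  to paths. Multiplicativity follows by removing the last edge of the second path and using
  associativity.\<close>

lemma (in semigroupoid) semigroupoid_hom_path_value:
  assumes Y: "wf_digraph Y" "verts Y \<subseteq> verts S"
    and val: "\<And>e. e \<in> arcs Y \<Longrightarrow>
      val e \<in> arcs S \<and> tail S (val e) = tail Y e \<and> head S (val e) = head Y e"
  shows "semigroupoid_hom (free_graph Y) (@) S m id (path_value m val)"
proof -
  interpret Y: wf_digraph Y by (fact Y)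
  have path: "path_value m val p \<in> arcs S \<and> tail S (path_value m val p) = tail Y (hd p) \<and>
      head S (path_value m val p) = head Y (last p)" if "p \<in> paths Y" for p
    using that
  proof (induction p rule: rev_induct)
    case (snoc e p)
    show ?case
    proof (cases "p = []")
      case True
      then show ?thesis
        using snoc.prems val by (simp add: Y.mem_paths_iff)
    next
      case False
      then have "p \<in> paths Y" "e \<in> arcs Y" "head Y (last p) = tail Y e"
        using snoc.prems by (auto simp: Y.mem_paths_iff successively_append_iff)
      then show ?thesis
        using snoc.IH False val[of e] by (simp add: mult_closed tail_mult head_mult)
    qed
  qed (simp add: Y.mem_paths_iff)
  moreover have "path_value m val (p @ q) = m (path_value m val p) (path_value m val q)"
    if "p \<in> paths Y" "q \<in> paths Y" "head Y (last p) = tail Y (hd q)" for p q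
    using that(2,3)
  proof (induction q rule: rev_induct)
    case (snoc e q)
    have "p \<noteq> []"
      using that(1) by (simp add: Y.mem_paths_iff)
    show ?case
    proof (cases "q = []")
      case True
      then show ?thesis
        using \<open>p \<noteq> []\<close> by simp
    next
      case False
      then have q: "q \<in> paths Y" "e \<in> arcs Y" "head Y (last q) = tail Y e"
        using snoc.prems by (auto simp: Y.mem_paths_iff successively_append_iff)
      moreover have "head Y (last p) = tail Y (hd q)"
        using snoc.prems(2) False by simp
      ultimately show ?thesis
        using snoc.IH False \<open>p \<noteq> []\<close> path[OF that(1)] path[OF q(1)] val[of e]
        by (simp add: mult_assoc)
    qed
  qed (simp add: Y.mem_paths_iff)
  ultimately show ?thesis
    using Y(2) by (auto simp: semigroupoid_hom_def free_graph_def)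
qed

section \<open>The given automatic structure for the Rees matrix semigroup\<close>

locale rees_automatic_structure = rees_matrix_data S m I \<Lambda> F G P
  for S :: "('v, 'a) pre_digraph" and m :: "'a \<Rightarrow> 'a \<Rightarrow> 'a"
    and I :: "'i set" and \<Lambda> :: "'l set"
    and F :: "'i \<Rightarrow> 'v" and G :: "'l \<Rightarrow> 'v" and P :: "'l \<Rightarrow> 'i \<Rightarrow> 'a" +
  fixes X :: "(unit, nat) pre_digraph" and K and \<rho>
  assumes automatic_structure:
    "automatic_structure (one_object (rees_carrier S I \<Lambda> F G)) (rees_mult m P) X K \<rho>"
begin

abbreviation M where "M \<equiv> rees_carrier S I \<Lambda> F G"
abbreviation mul where "mul \<equiv> rees_mult m P"
abbreviation A where "A \<equiv> arcs X"

definition row where "row a = fst (\<rho> [a])"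
definition entry where "entry a = fst (snd (\<rho> [a]))"
definition column where "column a = snd (snd (\<rho> [a]))"

lemma \<rho>_letter: "\<rho> [a] = (row a, entry a, column a)"
  by (simp add: row_def entry_def column_def)

lemma fin_digraph_X: "fin_digraph X"
proof -
  have "wf_digraph X" "finite A"
    using automatic_structure
    by (simp_all add: automatic_structure_def choice_of_representatives_def)
  then show ?thesis
    by (simp add: fin_digraph_def fin_digraph_axioms_def)
qed

lemma finite_A: "finite A"
  using fin_digraph_X by (rule fin_digraph.finite_arcs)

text \<open>The graph has only one vertex, so any two letters may follow each other.\<close>

lemma paths_X: "paths X = lists A - {[]}"
proof -
  have "wf_digraph X"
    using fin_digraph_X by (rule fin_digraph.axioms(1))
  then show ?thesis
    by (auto simp: wf_digraph.mem_paths_iff successively_conv_nth)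
qed

lemma
  shows K_subset: "K \<subseteq> lists A - {[]}"
    and \<rho>_K: "\<rho> ` K = M"
    and \<rho>_surj: "\<rho> ` (lists A - {[]}) = M"
    and \<rho>_append: "\<And>p q. p \<in> lists A - {[]} \<Longrightarrow> q \<in> lists A - {[]} \<Longrightarrow> \<rho> (p @ q) = mul (\<rho> p) (\<rho> q)"
  using automatic_structure paths_X
  by (auto simp: automatic_structure_def choice_of_representatives_def semigroupoid_hom_def
      free_graph_def one_object_def simp del: in_lists_conv_set)

lemma \<rho>_in_M: "w \<in> lists A \<Longrightarrow> w \<noteq> [] \<Longrightarrow> \<rho> w \<in> M"
  using \<rho>_surj by auto

lemma M_word:
  assumes "h \<in> M"
  obtains w where "w \<in> lists A" "w \<noteq> []" "\<rho> w = h"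
proof -
  have "h \<in> \<rho> ` (lists A - {[]})"
    using assms \<rho>_surj by simp
  then show ?thesis
    using that by blast
qed

lemma M_representative:
  assumes "h \<in> M"
  obtains k where "k \<in> K" "\<rho> k = h"
  using assms \<rho>_K by (metis imageE)

lemma letter:
  assumes "a \<in> A"
  shows "row a \<in> I" "entry a \<in> arcs S" "column a \<in> \<Lambda>"
    "tail S (entry a) = F (row a)" "head S (entry a) = G (column a)"
  using \<rho>_in_M[of "[a]"] assms by (auto simp: \<rho>_letter rees_carrier_def)

lemma recognizable_edge:
  assumes "a \<in> A"
  shows "recognizable {(u, v). u \<in> K \<and> v \<in> K \<and> \<rho> (u @ [a]) = \<rho> v}"
proof -
  have "synchronously_regular X (edge_relation X K \<rho> a)"
    using automatic_structure assms by (simp add: automatic_structure_def)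
  then show ?thesis
    by (simp add: synchronously_regular_iff[OF fin_digraph_X] edge_relation_def)
qed

lemma recognizable_vertex: "recognizable {(u, v). u \<in> K \<and> v \<in> K \<and> \<rho> u = \<rho> v}"
proof -
  have "() \<in> verts X"
    using automatic_structure
    by (simp add: automatic_structure_def choice_of_representatives_def one_object_def)
  then have "synchronously_regular X (vertex_relation X K \<rho> ())"
    using automatic_structure by (simp add: automatic_structure_def)
  then show ?thesis
    by (simp add: synchronously_regular_iff[OF fin_digraph_X] vertex_relation_def)
qed

section \<open>Row, middle component and column of the value of a word\<close>

lemma fst_\<rho>:
  assumes "w \<in> lists A" "w \<noteq> []"
  shows "fst (\<rho> w) = row (hd w)"
proof (cases w)
  case (Cons a w')
  then show ?thesis
    using assms \<rho>_append[of "[a]" w']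
    by (cases "w' = []") (auto simp: \<rho>_letter rees_mult_def split: prod.splits)
qed (use assms in simp)

lemma snd_snd_\<rho>:
  assumes "w \<in> lists A" "w \<noteq> []"
  shows "snd (snd (\<rho> w)) = column (last w)"
proof (cases w rule: rev_cases)
  case (snoc w' a)
  then show ?thesis
    using assms \<rho>_append[of w' "[a]"]
    by (cases "w' = []") (auto simp: \<rho>_letter rees_mult_def split: prod.splits)
qed (use assms in simp)

abbreviation middle where "middle w \<equiv> fst (snd (\<rho> w))"

lemma \<rho>_eq:
  assumes "w \<in> lists A" "w \<noteq> []"
  shows "\<rho> w = (row (hd w), middle w, column (last w))"
  using fst_\<rho>[OF assms] snd_snd_\<rho>[OF assms] by (simp add: prod_eq_iff)

lemma mul_\<rho>:
  assumes "w \<in> lists A" "w \<noteq> []"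
  shows "mul (\<rho> w) (j, y, l) =
    (row (hd w), m (m (middle w) (P (column (last w)) j)) y, l)"
  by (subst \<rho>_eq[OF assms]) (simp add: rees_mult_def)

lemma middle_arc:
  assumes "w \<in> lists A" "w \<noteq> []"
  shows "middle w \<in> arcs S" "tail S (middle w) = F (row (hd w))"
    "head S (middle w) = G (column (last w))"
  using \<rho>_in_M[OF assms] \<rho>_eq[OF assms] by (auto simp: rees_carrier_def)

text \<open>Each index in \<open>I\<close> is the row of some element of \<open>M\<close>, hence of
  the first letter of a word for it, so \<open>I\<close> is finite. Each object is the source of
  some arrow and hence in the image of \<open>F\<close>.\<close>

lemma finite_verts: "finite (verts S)"
proof -
  have "I \<subseteq> row ` A"
  proof
    fix i
    assume "i \<in> I"
    then obtain x where x: "x \<in> arcs S" "F i = tail S x"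
      using F_surj by blast
    then obtain l where "l \<in> \<Lambda>" "G l = head S x"
      using G_surj by (metis image_iff)
    then have "(i, x, l) \<in> M"
      using x \<open>i \<in> I\<close> by (simp add: rees_carrier_def)
    then obtain w where w: "w \<in> lists A" "w \<noteq> []" "\<rho> w = (i, x, l)"
      by (rule M_word)
    then have "i = row (hd w)" "hd w \<in> A"
      using fst_\<rho>[OF w(1,2)] hd_in_set[OF w(2)] by auto
    then show "i \<in> row ` A"
      by simp
  qed
  then have "finite (F ` I)"
    using finite_A by (meson finite_imageI finite_subset)
  moreover have "verts S \<subseteq> F ` I"
  proof
    fix v
    assume "v \<in> verts S"
    then obtain e where e: "e \<in> arcs S" "v = tail S e \<or> v = head S e"
      using isolation_free by (auto simp: isolation_free_def)
    obtain i l where il: "i \<in> I" "l \<in> \<Lambda>" "G l = head S e"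
      using e(1) F_surj G_surj by (metis image_iff)
    \<comment> \<open>A target of an arrow is also a source, because the entries of \<open>P\<close>
      in row \<open>l\<close> start there.\<close>
    have "head S e = tail S (P l i)"
      using P_tail il by simp
    then show "v \<in> F ` I"
      using e P_arcs[OF il(2,1)] unfolding F_surj by auto
  qed
  ultimately show ?thesis
    by (rule finite_subset[rotated])
qed

section \<open>Multiplying the words of \<open>K\<^sub>0\<close> by fixed elements of
  \<open>M\<close>\<close>

definition K\<^sub>0 where "K\<^sub>0 = insert [] K"

lemma K\<^sub>0_lists: "u \<in> K\<^sub>0 \<Longrightarrow> u \<in> lists A"
  using K_subset by (auto simp: K\<^sub>0_def)

text \<open>The empty word has no value in \<open>M\<close>; here it acts as an adjoined
  identity.\<close>

definition act where "act u h = (if u = [] then h else mul (\<rho> u) h)"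

lemma act_\<rho>: "u \<in> lists A \<Longrightarrow> w \<in> lists A \<Longrightarrow> w \<noteq> [] \<Longrightarrow> act u (\<rho> w) = \<rho> (u @ w)"
  using \<rho>_append[of u w] by (auto simp: act_def)

text \<open>Write \<open>h\<close> as the value of a word \<open>x\<close> and append its letters
  one at a time, returning to a representative in \<open>K\<close> after each. Every letter
  contributes one composition with an edge relation.\<close>

lemma recognizable_act:
  assumes "h \<in> M"
  shows "recognizable {(u, w). u \<in> K\<^sub>0 \<and> w \<in> K \<and> act u h = \<rho> w}"
proof -
  have "recognizable {(u, w). u \<in> K\<^sub>0 \<and> w \<in> K \<and> \<rho> (u @ x) = \<rho> w}" (is "recognizable (?N x)")
    if "x \<in> lists A" "x \<noteq> []" for x
    using that
  proof (induction x rule: rev_induct)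
    case (snoc a x)
    show ?case
    proof (cases "x = []")
      case True
      let ?E = "{(u, v). u \<in> K \<and> v \<in> K \<and> \<rho> (u @ [a]) = \<rho> v}"
      obtain k where k: "k \<in> K" "\<rho> k = \<rho> [a]"
        using M_representative[of "\<rho> [a]"] \<rho>_in_M[of "[a]"] snoc.prems by auto
      \<comment> \<open>The second part accounts for the empty prefix: the vertex relation leads
        from one representative \<open>k\<close> of the letter to all of them.\<close>
      have "?N (x @ [a]) = ?E \<union> {([], k)} O {(u, v). u \<in> K \<and> v \<in> K \<and> \<rho> u = \<rho> v}"
        using k True by (auto simp: K\<^sub>0_def)
      moreover have "recognizable ?E"
        using snoc.prems by (intro recognizable_edge) simp
      ultimately show ?thesis
        by (simp add: recognizable_Un recognizable_relcomp recognizable_finite recognizable_vertex)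
    next
      case False
      let ?E = "{(u, v). u \<in> K \<and> v \<in> K \<and> \<rho> (u @ [a]) = \<rho> v}"
      have x: "x \<in> lists A" "a \<in> A"
        using snoc.prems by auto
      have split: "\<rho> (u @ x @ [a]) = \<rho> (k @ [a])" if "u \<in> K\<^sub>0" "k \<in> K" "\<rho> (u @ x) = \<rho> k" for u k
      proof -
        have "k \<in> lists A - {[]}"
          using that(2) K_subset by blast
        then show ?thesis
          using that x False K\<^sub>0_lists[of u] \<rho>_append[of "u @ x" "[a]"] \<rho>_append[of k "[a]"]
          by auto
      qed
      have "?N (x @ [a]) = ?N x O ?E"
      proof (rule equalityI; rule subrelI)
        fix u w
        assume uw: "(u, w) \<in> ?N (x @ [a])"
        then have "\<rho> (u @ x) \<in> M"
          using \<rho>_in_M[of "u @ x"] x K\<^sub>0_lists[of u] False by auto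
        then obtain k where "k \<in> K" "\<rho> k = \<rho> (u @ x)"
          by (rule M_representative)
        then show "(u, w) \<in> ?N x O ?E"
          using uw split[of u k] by auto
      next
        fix u w
        assume "(u, w) \<in> ?N x O ?E"
        then show "(u, w) \<in> ?N (x @ [a])"
          using split by auto
      qed
      then show ?thesis
        using snoc.IH x False recognizable_edge[OF x(2)] by (simp add: recognizable_relcomp)
    qed
  qed simp
  moreover obtain x where x: "x \<in> lists A" "x \<noteq> []" "\<rho> x = h"
    using assms by (elim M_word)
  moreover have "{(u, w). u \<in> K\<^sub>0 \<and> w \<in> K \<and> act u h = \<rho> w}
      = {(u, w). u \<in> K\<^sub>0 \<and> w \<in> K \<and> \<rho> (u @ x) = \<rho> w}"
    using act_\<rho>[of _ x] K\<^sub>0_lists x by auto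
  ultimately show ?thesis
    by simp
qed

lemma act_in_M:
  assumes "u \<in> lists A" "h \<in> M"
  shows "act u h \<in> M"
proof -
  obtain x where "x \<in> lists A" "x \<noteq> []" "\<rho> x = h"
    using assms by (elim M_word)
  then show ?thesis
    using assms act_\<rho>[of u x] \<rho>_in_M[of "u @ x"] by auto
qed

text \<open>The common value lies in \<open>M\<close>, so it has a representative in
  \<open>K\<close> through which the relation factors.\<close>

lemma recognizable_act_eq:
  assumes "h \<in> M" "g \<in> M"
  shows "recognizable {(u, v). u \<in> K\<^sub>0 \<and> v \<in> K\<^sub>0 \<and> act u h = act v g}"
proof -
  let ?N = "\<lambda>h. {(u, w). u \<in> K\<^sub>0 \<and> w \<in> K \<and> act u h = \<rho> w}"
  have "\<exists>w \<in> K. act u h = \<rho> w" if "u \<in> K\<^sub>0" for u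
    using \<rho>_K act_in_M[OF K\<^sub>0_lists[OF that] assms(1)] by (metis imageE)
  then have "{(u, v). u \<in> K\<^sub>0 \<and> v \<in> K\<^sub>0 \<and> act u h = act v g} = ?N h O (?N g)\<inverse>"
    by (auto simp: relcomp_unfold) metis
  then show ?thesis
    using assms by (simp add: recognizable_relcomp recognizable_converse recognizable_act)
qed

section \<open>The graph of generators for \<open>S\<close> and the values of translated
  words\<close>

definition code_value :: "nat \<Rightarrow> 'a" where
  "code_value e = (case prod_decode e of
     (0, a) \<Rightarrow> entry a
   | (Suc b, a) \<Rightarrow> m (P (column b) (row a)) (entry a))"

text \<open>Every edge inherits source and target from the arrow that it stands for, so
  \<open>code_value\<close> is a graph map that fixes objects.\<close>

definition Y :: "('v, nat) pre_digraph" where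
  "Y = \<lparr>verts = verts S, arcs = prod_encode ` (insert 0 (Suc ` A) \<times> A),
     tail = tail S \<circ> code_value, head = head S \<circ> code_value\<rparr>"

lemma Y_simps [simp]:
  "verts Y = verts S" "tail Y e = tail S (code_value e)" "head Y e = head S (code_value e)"
  by (simp_all add: Y_def)

lemma arcs_Y: "arcs Y = prod_encode ` (insert 0 (Suc ` A) \<times> A)"
  by (simp add: Y_def)

lemma code_value_simps [simp]:
  "code_value (prod_encode (0, a)) = entry a"
  "code_value (prod_encode (Suc b, a)) = m (P (column b) (row a)) (entry a)"
  by (simp_all add: code_value_def)

text \<open>The source is the object where the arrow of the preceding letter \<open>b\<close> ends,
  so the codes of consecutive letters can be composed.\<close>

lemma code_value_Suc:
  assumes "a \<in> A" "b \<in> A"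
  shows "code_value (prod_encode (Suc b, a)) \<in> arcs S"
    and "tail S (code_value (prod_encode (Suc b, a))) = G (column b)"
    and "head S (code_value (prod_encode (Suc b, a))) = G (column a)"
  using letter[OF assms(1)] letter[OF assms(2)]
  by (auto simp: mult_closed tail_mult head_mult P_arcs P_tail P_head)

lemma code_value_arc:
  assumes "e \<in> arcs Y"
  shows "code_value e \<in> arcs S"
  using assms letter code_value_Suc by (auto simp: arcs_Y simp del: code_value_simps(2))

lemma fin_digraph_Y: "fin_digraph Y"
proof
  show "finite (verts Y)" "finite (arcs Y)"
    using finite_verts finite_A by (simp_all add: arcs_Y)
qed (use code_value_arc in auto)

sublocale Y: fin_digraph Y
  by (rule fin_digraph_Y)

lemma hom_path_value: "semigroupoid_hom (free_graph Y) (@) S m id (path_value m code_value)"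
  by (rule semigroupoid_hom_path_value) (auto simp: Y.wf_digraph_axioms code_value_arc)

text \<open>The middle component of a product interleaves the arrows of the letters with entries of
  \<open>P\<close>; the code groups each entry with the arrow after it. The end vertex is part of
  the claim so that the next edge can be attached in the induction.\<close>

lemma path_value_pair_code:
  assumes "w \<in> lists A" "w \<noteq> []"
  shows "pair_code w \<in> paths Y \<and> path_value m code_value (pair_code w) = middle w
    \<and> head Y (last (pair_code w)) = G (column (last w))"
  using assms
proof (induction w rule: rev_induct)
  case (snoc a w)
  show ?case
  proof (cases "w = []")
    case True
    then show ?thesis
      using snoc.prems letter[of a] by (auto simp: Y.mem_paths_iff arcs_Y \<rho>_letter)
  next
    case False
    have w: "w \<in> lists A" "a \<in> A" "last w \<in> A"
      using snoc.prems False by auto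
    define e where "e = prod_encode (Suc (last w), a)"
    have code: "pair_code (w @ [a]) = pair_code w @ [e]"
      using False by (simp add: pair_code_from_append code_state_def e_def)
    have ne: "pair_code w \<noteq> []"
      using False by (metis length_0_conv length_pair_code_from)
    have IH: "pair_code w \<in> paths Y" "path_value m code_value (pair_code w) = middle w"
      "head Y (last (pair_code w)) = G (column (last w))"
      using snoc.IH w False by auto
    have e: "code_value e \<in> arcs S" "tail S (code_value e) = G (column (last w))"
      "head S (code_value e) = G (column a)" "e \<in> arcs Y"
      using code_value_Suc[OF w(2,3)] w by (auto simp: e_def arcs_Y)
    have "pair_code w @ [e] \<in> paths Y"
      using IH(1,3) e ne by (auto simp: Y.mem_paths_iff successively_append_iff)
    moreover have "path_value m code_value (pair_code w @ [e]) = middle (w @ [a])"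
    proof -
      have "path_value m code_value (pair_code w @ [e]) = m (middle w) (code_value e)"
        using IH(2) ne by simp
      also have "\<dots> = m (m (middle w) (P (column (last w)) (row a))) (entry a)"
        using middle_arc[OF w(1) False] letter[OF w(2)] letter[OF w(3)]
        by (simp add: e_def mult_assoc P_arcs P_tail P_head)
      also have "\<dots> = middle (w @ [a])"
        using \<rho>_append[of w "[a]"] w False by (simp add: \<rho>_letter mul_\<rho>)
      finally show ?thesis .
    qed
    ultimately show ?thesis
      using e(3) by (simp add: code)
  qed
qed simp

section \<open>The language of representatives for \<open>S\<close>\<close>

definition H where "H = {a. row a = inv_into I F (F (row a))}"

definition L where "L = {pair_code (u @ [a]) |u a. u \<in> K\<^sub>0 \<and> a \<in> A \<and> hd (u @ [a]) \<in> H}"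

lemma L_code:
  assumes "U \<in> L"
  obtains u a where "U = pair_code (u @ [a])" "u \<in> K\<^sub>0" "a \<in> A" "hd (u @ [a]) \<in> H"
  using assms unfolding L_def by blast

text \<open>The row of a letter in \<open>H\<close> is the one that \<open>inv_into I F\<close>
  picks over its object. Equal sources in \<open>S\<close> therefore give back equal rows in
  \<open>M\<close>.\<close>

lemma row_eq:
  assumes "a \<in> H" "b \<in> H" "F (row a) = F (row b)"
  shows "row a = row b"
  using assms by (metis (mono_tags, lifting) H_def mem_Collect_eq)

lemma snoc_lists: "u \<in> K\<^sub>0 \<Longrightarrow> a \<in> A \<Longrightarrow> u @ [a] \<in> lists A"
  using K\<^sub>0_lists[of u] by simp

lemma L_subset_paths: "L \<subseteq> paths Y"
proof
  fix U
  assume "U \<in> L"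
  then obtain u a where "U = pair_code (u @ [a])" "u \<in> K\<^sub>0" "a \<in> A"
    by (rule L_code)
  then show "U \<in> paths Y"
    using path_value_pair_code[OF snoc_lists] by simp
qed

lemma path_value_L: "path_value m code_value ` L = arcs S"
proof (rule equalityI; rule subsetI)
  fix x
  assume "x \<in> path_value m code_value ` L"
  then show "x \<in> arcs S"
    using hom_path_value L_subset_paths by (auto simp: semigroupoid_hom_def free_graph_def)
next
  fix x
  assume x: "x \<in> arcs S"
  then obtain l where l: "l \<in> \<Lambda>" "G l = head S x"
    using G_surj by (metis image_iff)
  \<comment> \<open>Choosing this row over the source of \<open>x\<close> puts the first letter of
    any word for \<open>(i, x, l)\<close> into \<open>H\<close>.\<close>
  define i where "i = inv_into I F (tail S x)"
  have i: "i \<in> I" "F i = tail S x"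
    using x F_surj by (auto simp: i_def inv_into_into f_inv_into_f)
  then have "(i, x, l) \<in> M"
    using x l by (simp add: rees_carrier_def)
  then obtain w where w: "w \<in> lists A" "w \<noteq> []" "\<rho> w = (i, x, l)"
    by (rule M_word)
  define a where "a = last w"
  have a: "a \<in> A"
    using w by (auto simp: a_def)
  \<comment> \<open>The last letter is kept and what precedes it is replaced by a representative
    from \<open>K\<close>, if it is not empty.\<close>
  have "\<exists>u \<in> K\<^sub>0. \<rho> (u @ [a]) = \<rho> w"
  proof (cases "butlast w = []")
    case True
    then have "\<rho> ([] @ [a]) = \<rho> w"
      using append_butlast_last_id[OF w(2)] by (simp add: a_def)
    then show ?thesis
      by (auto simp: K\<^sub>0_def)
  next
    case False
    have lw: "butlast w \<in> lists A - {[]}"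
      using w(1) False by (auto dest: in_set_butlastD)
    obtain k where k: "k \<in> K" "\<rho> k = \<rho> (butlast w)"
      using lw \<rho>_in_M M_representative by blast
    have "k \<in> lists A - {[]}"
      using k(1) K_subset by blast
    then have "\<rho> (k @ [a]) = \<rho> (butlast w @ [a])"
      using \<rho>_append[of k "[a]"] \<rho>_append[OF lw, of "[a]"] k(2) a by simp
    then show ?thesis
      using k(1) append_butlast_last_id[OF w(2)] by (auto simp: K\<^sub>0_def a_def)
  qed
  then obtain u where u: "u \<in> K\<^sub>0" "\<rho> (u @ [a]) = (i, x, l)"
    using w(3) by auto
  have "row (hd (u @ [a])) = i"
    using fst_\<rho>[OF snoc_lists[OF u(1) a]] u(2) by simp
  then have "hd (u @ [a]) \<in> H"
    using i(2) by (simp add: H_def) (simp add: i_def)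
  then have "pair_code (u @ [a]) \<in> L"
    using u(1) a by (auto simp: L_def)
  moreover have "path_value m code_value (pair_code (u @ [a])) = x"
    using path_value_pair_code[OF snoc_lists[OF u(1) a]] u(2) by simp
  ultimately show "x \<in> path_value m code_value ` L"
    by (rule rev_image_eqI[OF _ sym])
qed

section \<open>Synchronous regularity of the relations on representatives\<close>

lemma act_entry:
  assumes "u \<in> K\<^sub>0" "a \<in> A"
  shows "act u (row a, entry a, l) = (row (hd (u @ [a])), middle (u @ [a]), l)"
proof (cases "u = []")
  case False
  then show ?thesis
    using \<rho>_append[of u "[a]"] assms K\<^sub>0_lists[OF assms(1)]
    by (simp add: act_def \<rho>_letter mul_\<rho>)
qed (simp add: act_def \<rho>_letter)

text \<open>Associativity moves \<open>t\<close> from the last factor to the end of the whole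
  product. As in \<open>act_entry\<close>, the column \<open>l\<close> is arbitrary, since the last
  factor alone determines the column.\<close>

lemma act_mult_entry:
  assumes "u \<in> K\<^sub>0" "a \<in> A" "t \<in> arcs S" "head S (entry a) = tail S t"
  shows "act u (row a, m (entry a) t, l) = (row (hd (u @ [a])), m (middle (u @ [a])) t, l)"
proof (cases "u = []")
  case False
  have u: "u \<in> lists A"
    using assms(1) by (rule K\<^sub>0_lists)
  have "last u \<in> A"
    using u False by auto
  note * = letter[OF this] letter[OF assms(2)] middle_arc[OF u False]
  have "middle (u @ [a]) = m (m (middle u) (P (column (last u)) (row a))) (entry a)"
    using \<rho>_append[of u "[a]"] u False assms(2) by (simp add: \<rho>_letter mul_\<rho>)
  moreover have "act u (row a, m (entry a) t, l) =
      (row (hd u), m (m (middle u) (P (column (last u)) (row a))) (m (entry a) t), l)"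
    using u False by (simp add: act_def mul_\<rho>)
  ultimately show ?thesis
    using False * assms(3,4)
    by (simp add: mult_assoc mult_closed tail_mult head_mult P_arcs P_tail P_head)
qed (simp add: act_def \<rho>_letter)

text \<open>The common form of the edge and vertex relations for \<open>S\<close>:
  \<open>z a\<close> is the arrow of the last letter after the operation in question, and it is
  given the column of \<open>b\<close> so that it can be compared in \<open>M\<close> with the value
  of \<open>v @ [b]\<close>.\<close>

definition code_relation :: "(nat \<times> nat) set \<Rightarrow> (nat \<Rightarrow> 'a) \<Rightarrow> (nat list \<times> nat list) set" where
  "code_relation D z = {(pair_code (u @ [a]), pair_code (v @ [b])) |u a v b.
     (a, b) \<in> D \<and> u \<in> K\<^sub>0 \<and> v \<in> K\<^sub>0 \<and> hd (u @ [a]) \<in> H \<and> hd (v @ [b]) \<in> H \<and>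
     act u (row a, z a, column b) = \<rho> (v @ [b])}"

lemma recognizable_code_relation:
  assumes D: "D \<subseteq> A \<times> A" and z: "\<And>a b. (a, b) \<in> D \<Longrightarrow> (row a, z a, column b) \<in> M"
  shows "recognizable (code_relation D z)"
proof -
  let ?C = "{(w, pair_code w) |w. w \<in> lists A}"
  let ?H = "{(w, w) |w. w \<noteq> [] \<and> hd w \<in> H}"
  let ?S = "\<lambda>a. range (\<lambda>u. (u, u @ [a]))"
  let ?T = "\<lambda>a b. {(u, v). u \<in> K\<^sub>0 \<and> v \<in> K\<^sub>0 \<and> act u (row a, z a, column b) = act v (\<rho> [b])}"
  \<comment> \<open>\<open>?R a\<close> sends \<open>u\<close> to the code of
    \<open>u @ [a]\<close>, provided that the first letter of this word is in
    \<open>H\<close>.\<close>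
  let ?R = "\<lambda>a. ?S a O ?H O ?C"
  have R: "(u, U) \<in> ?R a \<longleftrightarrow> u @ [a] \<in> lists A \<and> hd (u @ [a]) \<in> H \<and> U = pair_code (u @ [a])" for u U a
    by (auto simp: relcomp_unfold image_iff)
  have "code_relation D z = (\<Union>(a, b) \<in> D. (?R a)\<inverse> O ?T a b O ?R b)" (is "_ = ?U")
  proof (rule equalityI; rule subrelI)
    fix U V
    assume "(U, V) \<in> code_relation D z"
    then obtain u a v b where *: "U = pair_code (u @ [a])" "V = pair_code (v @ [b])"
      "(a, b) \<in> D" "u \<in> K\<^sub>0" "v \<in> K\<^sub>0" "hd (u @ [a]) \<in> H" "hd (v @ [b]) \<in> H"
      "act u (row a, z a, column b) = \<rho> (v @ [b])"
      unfolding code_relation_def by blast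
    have ab: "a \<in> A" "b \<in> A"
      using D *(3) by auto
    have uv: "(u, U) \<in> ?R a" "(v, V) \<in> ?R b"
      unfolding R using * snoc_lists[OF *(4) ab(1)] snoc_lists[OF *(5) ab(2)] by blast+
    have "(u, v) \<in> ?T a b"
      using * act_\<rho>[OF K\<^sub>0_lists[OF *(5)], of "[b]"] ab by simp
    then have "(U, V) \<in> (?R a)\<inverse> O ?T a b O ?R b"
      by (rule relcompI[OF converseI[OF uv(1)] relcompI[OF _ uv(2)]])
    then show "(U, V) \<in> ?U"
      by (intro UN_I[OF *(3)]) (simp only: prod.case)
  next
    fix U V
    assume "(U, V) \<in> ?U"
    then obtain a b u v where *: "(a, b) \<in> D" "(u, U) \<in> ?R a" "(u, v) \<in> ?T a b" "(v, V) \<in> ?R b"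
      by blast
    then have uv: "u \<in> K\<^sub>0" "v \<in> K\<^sub>0" "act u (row a, z a, column b) = act v (\<rho> [b])"
      and ab: "a \<in> A" "b \<in> A"
      using D by blast+
    have "act v (\<rho> [b]) = \<rho> (v @ [b])"
      using act_\<rho>[OF K\<^sub>0_lists[OF uv(2)], of "[b]"] ab by simp
    then show "(U, V) \<in> code_relation D z"
      using *(1) uv *(2,4)[unfolded R] unfolding code_relation_def by auto
  qed
  moreover have "recognizable ((?R a)\<inverse> O ?T a b O ?R b)" if "(a, b) \<in> D" for a b
  proof -
    have T: "recognizable (?T a b)"
      using z[OF that] \<rho>_in_M[of "[b]"] D that by (intro recognizable_act_eq) auto
    have R: "recognizable (?R a)" for a
      by (intro recognizable_relcomp recognizable_snoc recognizable_hd
          recognizable_pair_code[OF finite_A])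
    show ?thesis
      by (rule recognizable_relcomp[OF recognizable_converse[OF R] recognizable_relcomp[OF T R]])
  qed
  moreover have "finite D"
    using D finite_A by (meson finite_SigmaI finite_subset)
  ultimately show ?thesis
    by (simp add: recognizable_UN split_beta)
qed

text \<open>Here \<open>f\<close> stands for right multiplication by an arrow or for the identity
  map. An equation between arrows of \<open>S\<close> is lifted to \<open>M\<close>: the sources
  agree, so the rows agree by the choice of \<open>H\<close>, and the targets leave only finitely
  many pairs of last letters to consider.\<close>

lemma synchronously_regular_L_relation:
  fixes s s' :: 'v and z :: "nat \<Rightarrow> 'a" and f :: "'a \<Rightarrow> 'a"
  assumes z: "\<And>a. a \<in> A \<Longrightarrow> G (column a) = s \<Longrightarrow>
      z a \<in> arcs S \<and> tail S (z a) = F (row a) \<and> head S (z a) = s'"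
    and act: "\<And>u a l. u \<in> K\<^sub>0 \<Longrightarrow> a \<in> A \<Longrightarrow> G (column a) = s \<Longrightarrow>
      act u (row a, z a, l) = (row (hd (u @ [a])), f (middle (u @ [a])), l)"
    and f: "\<And>x. x \<in> arcs S \<Longrightarrow> head S x = s \<Longrightarrow> tail S (f x) = tail S x \<and> head S (f x) = s'"
  shows "synchronously_regular Y {(U, V). U \<in> L \<and> V \<in> L \<and> head Y (last U) = s \<and>
    f (path_value m code_value U) = path_value m code_value V}"
    (is "synchronously_regular Y ?R")
proof -
  let ?D = "{(a, b). a \<in> A \<and> b \<in> A \<and> G (column a) = s \<and> G (column b) = s'}"
  have iff: "(pair_code (u @ [a]), pair_code (v @ [b])) \<in> ?R \<longleftrightarrow>
      (a, b) \<in> ?D \<and> act u (row a, z a, column b) = \<rho> (v @ [b])"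
    if uv: "u \<in> K\<^sub>0" "v \<in> K\<^sub>0" "a \<in> A" "b \<in> A" "hd (u @ [a]) \<in> H" "hd (v @ [b]) \<in> H" for u a v b
  proof -
    define w w' where "w = u @ [a]" and "w' = v @ [b]"
    have w: "w \<in> lists A" "w \<noteq> []" "last w = a" and w': "w' \<in> lists A" "w' \<noteq> []" "last w' = b"
      using snoc_lists uv(1-4) unfolding w_def w'_def by auto
    have L: "pair_code w \<in> L" "pair_code w' \<in> L"
      using uv unfolding L_def w_def w'_def by blast+
    note code = path_value_pair_code[OF w(1,2)] path_value_pair_code[OF w'(1,2)]
    have "(pair_code w, pair_code w') \<in> ?R \<longleftrightarrow> G (column a) = s \<and> f (middle w) = middle w'"
      using L code w(3) by simp
    also have "\<dots> \<longleftrightarrow> (a, b) \<in> ?D \<and> act u (row a, z a, column b) = \<rho> w'"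
    proof
      assume *: "G (column a) = s \<and> f (middle w) = middle w'"
      have fm: "tail S (f (middle w)) = tail S (middle w)" "head S (f (middle w)) = s'"
        using f[of "middle w"] middle_arc[OF w(1,2)] w(3) * by auto
      then have "F (row (hd w)) = F (row (hd w'))" "G (column b) = s'"
        using middle_arc[OF w(1,2)] middle_arc[OF w'(1,2)] w'(3) * by auto
      moreover from this have "row (hd w) = row (hd w')"
        using uv(5,6) unfolding w_def w'_def by (intro row_eq)
      ultimately show "(a, b) \<in> ?D \<and> act u (row a, z a, column b) = \<rho> w'"
        using act[OF uv(1,3), of "column b"] \<rho>_eq[OF w'(1,2)] w'(3) uv(3,4) * by (simp add: w_def)
    next
      assume "(a, b) \<in> ?D \<and> act u (row a, z a, column b) = \<rho> w'"
      then show "G (column a) = s \<and> f (middle w) = middle w'"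
        using act[OF uv(1,3), of "column b"] \<rho>_eq[OF w'(1,2)] by (simp add: w_def)
    qed
    finally show ?thesis
      unfolding w_def w'_def .
  qed
  have "?R = code_relation ?D z"
  proof (rule equalityI; rule subrelI)
    fix U V
    assume UV: "(U, V) \<in> ?R"
    then obtain u a v b where *: "U = pair_code (u @ [a])" "u \<in> K\<^sub>0" "a \<in> A" "hd (u @ [a]) \<in> H"
      "V = pair_code (v @ [b])" "v \<in> K\<^sub>0" "b \<in> A" "hd (v @ [b]) \<in> H"
      unfolding L_def by blast
    have "(a, b) \<in> ?D \<and> act u (row a, z a, column b) = \<rho> (v @ [b])"
      using UV unfolding *(1,5) by (rule iffD1[OF iff[OF *(2,6,3,7,4,8)]])
    then show "(U, V) \<in> code_relation ?D z"
      unfolding code_relation_def using * by blast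
  next
    fix U V
    assume "(U, V) \<in> code_relation ?D z"
    then obtain u a v b where *: "U = pair_code (u @ [a])" "V = pair_code (v @ [b])" "(a, b) \<in> ?D"
      "u \<in> K\<^sub>0" "v \<in> K\<^sub>0" "hd (u @ [a]) \<in> H" "hd (v @ [b]) \<in> H"
      "act u (row a, z a, column b) = \<rho> (v @ [b])"
      unfolding code_relation_def by blast
    have "a \<in> A" "b \<in> A"
      using *(3) by auto
    then show "(U, V) \<in> ?R"
      unfolding *(1,2) by (rule iffD2[OF iff[OF *(4,5) _ _ *(6,7)]]) (use *(3,8) in simp)
  qed
  moreover have "recognizable (code_relation ?D z)"
    using z letter by (intro recognizable_code_relation) (auto simp: rees_carrier_def)
  moreover have "?R \<subseteq> paths Y \<times> paths Y"
    using L_subset_paths by blast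
  ultimately show ?thesis
    by (simp add: synchronously_regular_iff[OF fin_digraph_Y])
qed

lemma automatic_structure_S: "automatic_structure S m Y L (path_value m code_value)"
proof -
  have "path_value m code_value ` paths Y \<subseteq> arcs S"
    using hom_path_value by (simp add: semigroupoid_hom_def free_graph_def)
  then have "path_value m code_value ` paths Y = arcs S"
    using image_mono[OF L_subset_paths, of "path_value m code_value"] path_value_L
    by (intro equalityI) simp_all
  then have "choice_of_representatives S m Y L (path_value m code_value)"
    using hom_path_value L_subset_paths path_value_L Y.wf_digraph_axioms
    by (simp add: choice_of_representatives_def)
  moreover have "synchronously_regular Y (edge_relation Y L (path_value m code_value) e)"
    if e: "e \<in> arcs Y" for e
  proof -
    let ?t = "code_value e"
    note t = code_value_arc[OF e]
    have "path_value m code_value (U @ [e]) = m (path_value m code_value U) ?t" if "U \<in> L" for U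
      using that L_subset_paths by (auto simp: Y.mem_paths_iff)
    then have "edge_relation Y L (path_value m code_value) e =
        {(U, V). U \<in> L \<and> V \<in> L \<and> head Y (last U) = tail S ?t \<and>
          m (path_value m code_value U) ?t = path_value m code_value V}"
      unfolding edge_relation_def Y_simps by auto
    moreover have "synchronously_regular Y \<dots>"
    \<comment> \<open>Here \<open>f\<close> is right multiplication by \<open>?t\<close>, which acts
      on the last letter alone and ends at the target of \<open>?t\<close>.\<close>
    proof (rule synchronously_regular_L_relation)
      show "m (entry a) ?t \<in> arcs S \<and> tail S (m (entry a) ?t) = F (row a) \<and>
          head S (m (entry a) ?t) = head S ?t"
        if "a \<in> A" "G (column a) = tail S ?t" for a
        using letter[OF that(1)] that(2) t by (simp add: mult_closed tail_mult head_mult)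
      show "act u (row a, m (entry a) ?t, l) = (row (hd (u @ [a])), m (middle (u @ [a])) ?t, l)"
        if "u \<in> K\<^sub>0" "a \<in> A" "G (column a) = tail S ?t" for u a l
        using that letter[OF that(2)] t by (intro act_mult_entry) simp_all
    qed (use t in \<open>simp add: tail_mult head_mult\<close>)
    ultimately show ?thesis
      by simp
  qed
  moreover have "synchronously_regular Y (vertex_relation Y L (path_value m code_value) s)" for s
  proof -
    have "vertex_relation Y L (path_value m code_value) s = {(U, V). U \<in> L \<and> V \<in> L \<and>
        head Y (last U) = s \<and> path_value m code_value U = path_value m code_value V}"
      by (simp add: vertex_relation_def)
    moreover have "synchronously_regular Y \<dots>"
      by (rule synchronously_regular_L_relation[where f = "\<lambda>x. x" and z = entry and s' = s])
        (simp_all add: letter act_entry)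
    ultimately show ?thesis
      by simp
  qed
  ultimately show ?thesis
    by (simp add: automatic_structure_def)
qed

end

theorem theorem6p2:
  fixes S :: "('v, 'a) pre_digraph" and m :: "'a \<Rightarrow> 'a \<Rightarrow> 'a"
    and I :: "'i set" and \<Lambda> :: "'l set"
    and F :: "'i \<Rightarrow> 'v" and G :: "'l \<Rightarrow> 'v" and P :: "'l \<Rightarrow> 'i \<Rightarrow> 'a"
  assumes "rees_matrix_data S m I \<Lambda> F G P"
    and "weakly_right_ideal_generated S m I \<Lambda> G P {s \<in> arcs S. \<not> is_identity S m s}"
    and "automatic (one_object (rees_carrier S I \<Lambda> F G)) (rees_mult m P)"
  shows "automatic S m"
proof -
  obtain X K \<rho> where
    "automatic_structure (one_object (rees_carrier S I \<Lambda> F G)) (rees_mult m P)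
      (X :: (unit, nat) pre_digraph) K \<rho>"
    using assms(3) by (auto simp: automatic_def)
  then interpret rees_automatic_structure S m I \<Lambda> F G P X K \<rho>
    using assms(1)
    by (simp add: rees_automatic_structure_def rees_automatic_structure_axioms_def)
  show ?thesis
    using automatic_structure_S by (auto simp: automatic_def)
qed

end
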